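(* If $M:\langle\Gamma\vdash U\rangle$ and $M\rhd_\beta N$ (one step), then $N:\langle\Gamma\restriction_N\vdash U\rangle$.
   Context: Terms: $\mathcal V$ is a denumerably infinite set of variables; $\mathcal M$ is the set of untyped $\lambda$-terms $M::=x\mid \lambda x.M\mid MM$ taken modulo $\alpha$-conversion; $FV(M)$ is the set of free variables; $M[x:=N]$ is capture-avoiding substitution. $\rhd_\beta$ is the compatible closure of $(\lambda x.M)N\rhd_\beta M[x:=N]$. Types: $\mathcal A$ is a denumerably infinite set of atomic types; $\mathbb T::=a\mid \mathbb U\to\mathbb T$ ($a\in\mathcal A$) and $\mathbb U::=\omega\mid \mathbb U\sqcap\mathbb U\mid \mathbb T$; types are quotiented by commutativity, associativity and idempotence of $\sqcap$ and by $\omega\sqcap U=U$. $T$ ranges over $\mathbb T$, $U,V$ over $\mathbb U$. Environments: a type environment is a finite set $(x_i:U_i)_n$ of declarations with pairwise distinct variables; $dom$ is its set of variables; $\Gamma,x:U$ requires $x\notin dom(\Gamma)$; $env^M_\omega$ assigns $\omega$ to each variable of $FV(M)$ and nothing else; if $\Gamma_1=(x_i:U_i)_n,(y_j:V_j)_m$ and $\Gamma_2=(x_i:U'_i)_n,(z_k:W_k)_l$ with the $y_j$, $z_k$ all distinct, then $\Gamma_1\sqcap\Gamma_2=(x_i:U_i\sqcap U'_i)_n,(y_j:V_j)_m,(z_k:W_k)_l$. For $\mathcal U\subseteq dom(\Gamma)$, $\Gamma\restriction_{\mathcal U}$ is the restriction of $\Gamma$ to the variables in $\mathcal U$, and $\Gamma\restriction_N$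 means $\Gamma\restriction_{FV(N)}$. Subtyping: $\sqsubseteq$ (on types, on environments, and on typings $\langle\Gamma\vdash U\rangle$) is the least relation closed under: $\Phi\sqsubseteq\Phi$; transitivity; $U_1\sqcap U_2\sqsubseteq U_1$; if $U_1\sqsubseteq V_1$ and $U_2\sqsubseteq V_2$ then $U_1\sqcap U_2\sqsubseteq V_1\sqcap V_2$; if $U_2\sqsubseteq U_1$ and $T_1\sqsubseteq T_2$ then $U_1\to T_1\sqsubseteq U_2\to T_2$; if $U_1\sqsubseteq U_2$ and $x\notin dom(\Gamma)$ then $\Gamma,x:U_1\sqsubseteq\Gamma,x:U_2$; if $U_1\sqsubseteq U_2$ and $\Gamma_2\sqsubseteq\Gamma_1$ then $\langle\Gamma_1\vdash U_1\rangle\sqsubseteq\langle\Gamma_2\vdash U_2\rangle$. Typing rules for $M:\langle\Gamma\vdash U\rangle$: (ax) $x:\langle x:T\vdash T\rangle$ for $T\in\mathbb T$; ($\omega$) $M:\langle env^M_\omega\vdash\omega\rangle$; ($\to_i$) from $M:\langle\Gamma,x:U\vdash T\rangle$ infer $\lambda x.M:\langle\Gamma\vdash U\to T\rangle$; ($\to'_i$) from $M:\langle\Gamma\vdash T\rangle$ and $x\notin dom(\Gamma)$ infer $\lambda x.M:\langle\Gamma\vdash\omega\to T\rangle$; ($\to_e$) from $M_1:\langle\Gamma_1\vdash U\to T\rangle$ and $M_2:\langle\Gamma_2\vdash U\rangle$ infer $M_1M_2:\langle\Gamma_1\sqcap\Gamma_2\vdash T\rangle$; ($\sqcap_i$) from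 $M:\langle\Gamma\vdash U_1\rangle$ and $M:\langle\Gamma\vdash U_2\rangle$ infer $M:\langle\Gamma\vdash U_1\sqcap U_2\rangle$; ($\sqsubseteq$) from $M:\langle\Gamma\vdash U\rangle$ and $\langle\Gamma\vdash U\rangle\sqsubseteq\langle\Gamma'\vdash U'\rangle$ infer $M:\langle\Gamma'\vdash U'\rangle$. *)

theory Defs
  imports "HOL-Library.Finite_Map"
begin

section \<open>Terms modulo alpha-conversion\<close>

type_synonym var = nat

datatype rterm = RVar var | RLam var rterm | RApp rterm rterm

primrec rFV :: "rterm \<Rightarrow> var set" where
  "rFV (RVar x) = {x}"
| "rFV (RLam x M) = rFV M - {x}"
| "rFV (RApp M N) = rFV M \<union> rFV N"

definition fresh :: "var set \<Rightarrow> var" where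
  "fresh S = (SOME z. z \<notin> S)"

text \<open>Simultaneous capture-avoiding substitution. Every traversed binder is renamed (Stoughton's
  definition), so that recursion is structural. The new name depends only on the set of variables
  to be avoided, hence alpha-equivalent terms have equal images.\<close>

primrec rsubst :: "rterm \<Rightarrow> (var \<Rightarrow> rterm) \<Rightarrow> rterm" where
  "rsubst (RVar x) \<sigma> = \<sigma> x"
| "rsubst (RLam x M) \<sigma> =
     (let z = fresh (\<Union>y \<in> rFV M - {x}. rFV (\<sigma> y)) in RLam z (rsubst M (\<sigma>(x := RVar z))))"
| "rsubst (RApp M N) \<sigma> = RApp (rsubst M \<sigma>) (rsubst N \<sigma>)"

inductive alpha :: "rterm \<Rightarrow> rterm \<Rightarrow> bool" where
  alpha_rename: "y \<notin> rFV (RLam x M) \<Longrightarrow> alpha (RLam x M) (RLam y (rsubst M (RVar(x := RVar y))))"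
| alpha_refl: "alpha M M"
| alpha_sym: "alpha M N \<Longrightarrow> alpha N M"
| alpha_trans: "alpha M N \<Longrightarrow> alpha N P \<Longrightarrow> alpha M P"
| alpha_lam: "alpha M N \<Longrightarrow> alpha (RLam x M) (RLam x N)"
| alpha_app: "alpha M M' \<Longrightarrow> alpha N N' \<Longrightarrow> alpha (RApp M N) (RApp M' N')"

lemma finite_rFV [simp]: "finite (rFV M)"
  by (induction M) auto

lemma fresh_notin: "finite S \<Longrightarrow> fresh S \<notin> S"
  unfolding fresh_def by (rule someI_ex) (rule ex_new_if_finite[OF infinite_UNIV_nat])

lemma rsubst_cong: "(\<And>y. y \<in> rFV M \<Longrightarrow> \<sigma> y = \<tau> y) \<Longrightarrow> rsubst M \<sigma> = rsubst M \<tau>"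
proof (induction M arbitrary: \<sigma> \<tau>)
  case (RLam x M)
  have "(\<Union>y \<in> rFV M - {x}. rFV (\<sigma> y)) = (\<Union>y \<in> rFV M - {x}. rFV (\<tau> y))"
    using RLam.prems by auto
  moreover have "rsubst M (\<sigma>(x := RVar z)) = rsubst M (\<tau>(x := RVar z))" for z
    by (rule RLam.IH) (use RLam.prems in auto)
  ultimately show ?case by (simp add: Let_def)
next
  case (RApp M N)
  then show ?case by (metis UnCI rFV.simps(3) rsubst.simps(3))
qed auto

lemma rFV_rsubst: "rFV (rsubst M \<sigma>) = (\<Union>y \<in> rFV M. rFV (\<sigma> y))"
proof (induction M arbitrary: \<sigma>)
  case (RLam x M)
  let ?S = "\<Union>y \<in> rFV M - {x}. rFV (\<sigma> y)"
  have "fresh ?S \<notin> ?S" by (rule fresh_notin) auto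
  then show ?case by (auto simp: Let_def RLam.IH split: if_splits)
qed auto

lemma rsubst_comp: "rsubst (rsubst M \<sigma>) \<tau> = rsubst M (\<lambda>y. rsubst (\<sigma> y) \<tau>)"
proof (induction M arbitrary: \<sigma> \<tau>)
  case (RLam x M)
  define z where "z = fresh (\<Union>y \<in> rFV M - {x}. rFV (\<sigma> y))"
  define w where "w = fresh (\<Union>y \<in> rFV M - {x}. rFV (rsubst (\<sigma> y) \<tau>))"
  have z: "z \<notin> (\<Union>y \<in> rFV M - {x}. rFV (\<sigma> y))"
    unfolding z_def by (rule fresh_notin) auto
  have "rFV (rsubst M (\<sigma>(x := RVar z))) - {z} = (\<Union>y \<in> rFV M - {x}. rFV (\<sigma> y))"
    using z by (auto simp: rFV_rsubst split: if_splits)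
  then have "(\<Union>y \<in> rFV (rsubst M (\<sigma>(x := RVar z))) - {z}. rFV (\<tau> y))
      = (\<Union>y \<in> rFV M - {x}. rFV (rsubst (\<sigma> y) \<tau>))"
    by (simp add: rFV_rsubst)
  then have L: "rsubst (rsubst (RLam x M) \<sigma>) \<tau>
      = RLam w (rsubst (rsubst M (\<sigma>(x := RVar z))) (\<tau>(z := RVar w)))"
    by (simp add: Let_def z_def[symmetric] w_def)
  have "rsubst (rsubst M (\<sigma>(x := RVar z))) (\<tau>(z := RVar w))
      = rsubst M (\<lambda>y. rsubst ((\<sigma>(x := RVar z)) y) (\<tau>(z := RVar w)))"
    by (rule RLam.IH)
  also have "\<dots> = rsubst M ((\<lambda>y. rsubst (\<sigma> y) \<tau>)(x := RVar w))"
  proof (rule rsubst_cong)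
    fix y assume y: "y \<in> rFV M"
    show "rsubst ((\<sigma>(x := RVar z)) y) (\<tau>(z := RVar w)) = ((\<lambda>y. rsubst (\<sigma> y) \<tau>)(x := RVar w)) y"
    proof (cases "y = x")
      case False
      then have "z \<notin> rFV (\<sigma> y)" using y z by blast
      then have "rsubst (\<sigma> y) (\<tau>(z := RVar w)) = rsubst (\<sigma> y) \<tau>"
        by (intro rsubst_cong) auto
      then show ?thesis using False by simp
    qed simp
  qed
  finally show ?case unfolding L by (simp add: Let_def w_def)
qed auto

lemma alpha_rFV: "alpha M N \<Longrightarrow> rFV M = rFV N"
  by (induction rule: alpha.induct) (auto simp: rFV_rsubst split: if_splits)

lemma alpha_rsubst_eq: "alpha M N \<Longrightarrow> rsubst M \<sigma> = rsubst N \<sigma>"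
proof (induction arbitrary: \<sigma> rule: alpha.induct)
  case (alpha_rename y x M)
  let ?M = "rsubst M (RVar(x := RVar y))"
  have "rFV ?M - {y} = rFV M - {x}"
    using alpha_rename by (auto simp: rFV_rsubst split: if_splits)
  moreover have "rsubst ?M (\<sigma>(y := RVar z)) = rsubst M (\<sigma>(x := RVar z))" for z
    unfolding rsubst_comp by (rule rsubst_cong) (use alpha_rename in auto)
  ultimately show ?case by (simp add: Let_def)
next
  case (alpha_lam M N x)
  then show ?case by (simp only: rsubst.simps alpha_rFV[OF alpha_lam.hyps])
qed simp_all

lemma alpha_rsubst_cong: "(\<And>y. alpha (\<sigma> y) (\<tau> y)) \<Longrightarrow> alpha (rsubst M \<sigma>) (rsubst M \<tau>)"
proof (induction M arbitrary: \<sigma> \<tau>)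
  case (RLam x M)
  have "rFV (\<sigma> y) = rFV (\<tau> y)" for y using RLam.prems alpha_rFV by blast
  moreover have "alpha (rsubst M (\<sigma>(x := RVar z))) (rsubst M (\<tau>(x := RVar z)))" for z
    by (rule RLam.IH) (use RLam.prems in \<open>auto intro: alpha_refl\<close>)
  ultimately show ?case by (simp add: Let_def alpha_lam)
qed (auto intro: alpha_app)

lemma equivp_alpha: "equivp alpha"
  by (rule equivpI)
    (auto simp: reflp_def symp_def transp_def intro: alpha_refl alpha_sym alpha_trans)

quotient_type lterm = rterm / alpha
  by (rule equivp_alpha)

lift_definition Var :: "var \<Rightarrow> lterm" is RVar .

lift_definition Lam :: "var \<Rightarrow> lterm \<Rightarrow> lterm" is RLam
  by (rule alpha_lam)

lift_definition App :: "lterm \<Rightarrow> lterm \<Rightarrow> lterm" is RApp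
  by (rule alpha_app)

lift_definition FV :: "lterm \<Rightarrow> var set" is rFV
  by (rule alpha_rFV)

lift_definition subst :: "lterm \<Rightarrow> var \<Rightarrow> lterm \<Rightarrow> lterm" (\<open>_[_ ::= _]\<close> [1000, 0, 0] 1000)
  is "\<lambda>M x N. rsubst M (RVar(x := N))"
proof -
  fix M M' N N' :: rterm and x :: var
  assume M: "alpha M M'" and N: "alpha N N'"
  have "rsubst M (RVar(x := N)) = rsubst M' (RVar(x := N))"
    by (rule alpha_rsubst_eq[OF M])
  also have "alpha (rsubst M' (RVar(x := N))) (rsubst M' (RVar(x := N')))"
    by (rule alpha_rsubst_cong) (use N in \<open>auto intro: alpha_refl\<close>)
  finally show "alpha (rsubst M (RVar(x := N))) (rsubst M' (RVar(x := N')))" .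
qed

lemma FV_simps [simp]:
  "FV (Var x) = {x}"
  "FV (Lam x M) = FV M - {x}"
  "FV (App M N) = FV M \<union> FV N"
  by (transfer, simp)+

lemma finite_FV [simp]: "finite (FV M)"
  by transfer simp

lemma Lam_rename: "y \<notin> FV (Lam x M) \<Longrightarrow> Lam x M = Lam y (M[x ::= Var y])"
  by transfer (rule alpha_rename)

lemma subst_simps:
  "(Var x)[x ::= N] = N"
  "y \<noteq> x \<Longrightarrow> (Var y)[x ::= N] = Var y"
  "(App M P)[x ::= N] = App (M[x ::= N]) (P[x ::= N])"
  by (transfer, simp add: alpha_refl)+

lemma rsubst_RLam:
  assumes "y \<notin> (\<Union>w \<in> rFV M - {y}. rFV (\<sigma> w))"
  shows "alpha (rsubst (RLam y M) \<sigma>) (RLam y (rsubst M (\<sigma>(y := RVar y))))"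
proof -
  define z where "z = fresh (\<Union>w \<in> rFV M - {y}. rFV (\<sigma> w))"
  have z: "z \<notin> (\<Union>w \<in> rFV M - {y}. rFV (\<sigma> w))"
    unfolding z_def by (rule fresh_notin) auto
  let ?P = "rsubst M (\<sigma>(y := RVar y))"
  have "z \<notin> rFV (RLam y ?P)"
    using z by (auto simp: rFV_rsubst split: if_splits)
  then have "alpha (RLam y ?P) (RLam z (rsubst ?P (RVar(y := RVar z))))"
    by (rule alpha_rename)
  also have "rsubst ?P (RVar(y := RVar z))
      = rsubst M (\<lambda>w. rsubst ((\<sigma>(y := RVar y)) w) (RVar(y := RVar z)))"
    by (rule rsubst_comp)
  also have "alpha (RLam z \<dots>) (RLam z (rsubst M (\<sigma>(y := RVar z))))"
  proof (rule alpha_lam)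
    let ?g = "\<lambda>w. if w \<in> rFV M then rsubst ((\<sigma>(y := RVar y)) w) (RVar(y := RVar z))
      else (\<sigma>(y := RVar z)) w"
    have id: "alpha (rsubst Q RVar) Q" for Q
    proof (induction Q)
      case (RLam x Q)
      let ?f = "fresh (\<Union>w \<in> rFV Q - {x}. rFV (RVar w))"
      have "?f \<notin> rFV (RLam x Q)"
        using fresh_notin[of "\<Union>w \<in> rFV Q - {x}. rFV (RVar w)"] by auto
      then show ?case by (simp only: rsubst.simps Let_def) (rule alpha_sym, rule alpha_rename)
    qed (auto intro: alpha_refl alpha_app)
    have "rsubst M (\<lambda>w. rsubst ((\<sigma>(y := RVar y)) w) (RVar(y := RVar z))) = rsubst M ?g"
      by (rule rsubst_cong) simp
    also have "alpha (rsubst M ?g) (rsubst M (\<sigma>(y := RVar z)))"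
    proof (rule alpha_rsubst_cong)
      fix w
      show "alpha (?g w) ((\<sigma>(y := RVar z)) w)"
      proof (cases "w \<notin> rFV M \<or> w = y")
        case True
        then have "?g w = (\<sigma>(y := RVar z)) w" by (elim disjE) simp_all
        then show ?thesis by (simp only: alpha_refl)
      next
        case False
        then have "y \<notin> rFV (\<sigma> w)" using assms by auto
        then have "rsubst (\<sigma> w) (RVar(y := RVar z)) = rsubst (\<sigma> w) RVar"
          by (intro rsubst_cong) auto
        then show ?thesis using False id[of "\<sigma> w"] by simp
      qed
    qed
    finally show "alpha (rsubst M (\<lambda>w. rsubst ((\<sigma>(y := RVar y)) w) (RVar(y := RVar z))))
      (rsubst M (\<sigma>(y := RVar z)))" .
  qed
  finally (alpha_trans) have "alpha (RLam y ?P) (RLam z (rsubst M (\<sigma>(y := RVar z))))" .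
  then show ?thesis by (simp add: Let_def z_def alpha_sym)
qed

lemma subst_Lam:
  "y \<noteq> x \<Longrightarrow> y \<notin> FV N \<Longrightarrow> (Lam y M)[x ::= N] = Lam y (M[x ::= N])"
proof transfer
  fix y x N M
  assume *: "y \<noteq> x" "y \<notin> rFV N"
  have "alpha (rsubst (RLam y M) (RVar(x := N)))
      (RLam y (rsubst M ((RVar(x := N))(y := RVar y))))"
    by (rule rsubst_RLam) (use * in \<open>auto split: if_splits\<close>)
  also have "(RVar(x := N))(y := RVar y) = RVar(x := N)"
    using *(1) by (simp add: fun_upd_idem)
  finally show "alpha (rsubst (RLam y M) (RVar(x := N))) (RLam y (rsubst M (RVar(x := N))))" .
qed

inductive beta :: "lterm \<Rightarrow> lterm \<Rightarrow> bool" (infix \<open>\<rhd>\<^sub>\<beta>\<close> 50) where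
  beta_redex: "App (Lam x M) N \<rhd>\<^sub>\<beta> M[x ::= N]"
| beta_lam: "M \<rhd>\<^sub>\<beta> M' \<Longrightarrow> Lam x M \<rhd>\<^sub>\<beta> Lam x M'"
| beta_appL: "M \<rhd>\<^sub>\<beta> M' \<Longrightarrow> App M N \<rhd>\<^sub>\<beta> App M' N"
| beta_appR: "N \<rhd>\<^sub>\<beta> N' \<Longrightarrow> App M N \<rhd>\<^sub>\<beta> App M N'"


section \<open>Types\<close>

type_synonym atom = nat

datatype rty = RAtom atom | RArrow rity rty
and rity = ROmega | RInter rity rity | REmb rty

text \<open>The congruence generated by the laws of intersection, on both sorts of types.\<close>

inductive ty_eq :: "rty \<Rightarrow> rty \<Rightarrow> bool" and ity_eq :: "rity \<Rightarrow> rity \<Rightarrow> bool" where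
  ty_refl: "ty_eq T T"
| ty_sym: "ty_eq T1 T2 \<Longrightarrow> ty_eq T2 T1"
| ty_trans: "ty_eq T1 T2 \<Longrightarrow> ty_eq T2 T3 \<Longrightarrow> ty_eq T1 T3"
| ty_arrow: "ity_eq U1 U2 \<Longrightarrow> ty_eq T1 T2 \<Longrightarrow> ty_eq (RArrow U1 T1) (RArrow U2 T2)"
| ity_refl: "ity_eq U U"
| ity_sym: "ity_eq U1 U2 \<Longrightarrow> ity_eq U2 U1"
| ity_trans: "ity_eq U1 U2 \<Longrightarrow> ity_eq U2 U3 \<Longrightarrow> ity_eq U1 U3"
| ity_inter: "ity_eq U1 U2 \<Longrightarrow> ity_eq V1 V2 \<Longrightarrow> ity_eq (RInter U1 V1) (RInter U2 V2)"
| ity_emb: "ty_eq T1 T2 \<Longrightarrow> ity_eq (REmb T1) (REmb T2)"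
| ity_comm: "ity_eq (RInter U V) (RInter V U)"
| ity_assoc: "ity_eq (RInter U (RInter V W)) (RInter (RInter U V) W)"
| ity_idem: "ity_eq (RInter U U) U"
| ity_omega: "ity_eq (RInter ROmega U) U"

quotient_type ty = rty / ty_eq
  by (rule equivpI) (auto simp: reflp_def symp_def transp_def intro: ty_refl ty_sym ty_trans)

quotient_type ity = rity / ity_eq
  by (rule equivpI) (auto simp: reflp_def symp_def transp_def intro: ity_refl ity_sym ity_trans)

lift_definition Atom :: "atom \<Rightarrow> ty" is RAtom .

lift_definition Arrow :: "ity \<Rightarrow> ty \<Rightarrow> ty" (infixr \<open>\<^bold>\<rightarrow>\<close> 65) is RArrow
  by (rule ty_arrow)

lift_definition Omega :: ity (\<open>\<omega>\<close>) is ROmega .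

lift_definition Inter :: "ity \<Rightarrow> ity \<Rightarrow> ity" (infixl \<open>\<sqinter>\<close> 70) is RInter
  by (rule ity_inter)

text \<open>The inclusion of the types \<open>T\<close> (type \<open>ty\<close>) among the types \<open>U\<close> (type \<open>ity\<close>).\<close>

lift_definition Emb :: "ty \<Rightarrow> ity" is REmb
  by (rule ity_emb)

lemma Inter_laws:
  "U \<sqinter> V = V \<sqinter> U"
  "U \<sqinter> (V \<sqinter> W) = (U \<sqinter> V) \<sqinter> W"
  "U \<sqinter> U = U"
  "\<omega> \<sqinter> U = U"
  by (transfer, rule ity_comm ity_assoc ity_idem ity_omega)+


section \<open>Environments\<close>

type_synonym env = "(var, ity) fmap"

context includes fmap.lifting begin

lift_definition env_omega :: "lterm \<Rightarrow> env" is "\<lambda>M x. if x \<in> FV M then Some \<omega> else None"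
proof -
  fix M
  have "dom (\<lambda>x. if x \<in> FV M then Some \<omega> else None) = FV M"
    by (auto split: if_splits)
  then show "finite (dom (\<lambda>x. if x \<in> FV M then Some \<omega> else None))"
    by simp
qed

lift_definition env_inter :: "env \<Rightarrow> env \<Rightarrow> env" (infixl \<open>\<sqinter>\<^sub>e\<close> 70) is
  "\<lambda>\<Gamma>1 \<Gamma>2 x. case (\<Gamma>1 x, \<Gamma>2 x) of
     (Some U, Some V) \<Rightarrow> Some (U \<sqinter> V)
   | (Some U, None) \<Rightarrow> Some U
   | (None, V) \<Rightarrow> V"
proof -
  fix \<Gamma>1 \<Gamma>2 :: "var \<Rightarrow> ity option"
  assume "finite (dom \<Gamma>1)" "finite (dom \<Gamma>2)"
  then have "finite (dom \<Gamma>1 \<union> dom \<Gamma>2)" by simp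
  then show "finite (dom (\<lambda>x. case (\<Gamma>1 x, \<Gamma>2 x) of
     (Some U, Some V) \<Rightarrow> Some (U \<sqinter> V)
   | (Some U, None) \<Rightarrow> Some U
   | (None, V) \<Rightarrow> V))"
    by (rule rev_finite_subset) (auto split: option.splits)
qed

end

definition env_restrict :: "env \<Rightarrow> lterm \<Rightarrow> env" (infixl \<open>\<restriction>\<close> 80) where
  "\<Gamma> \<restriction> M = fmrestrict_set (FV M) \<Gamma>"


section \<open>Subtyping\<close>

inductive sub_ity :: "ity \<Rightarrow> ity \<Rightarrow> bool" (infix \<open>\<sqsubseteq>\<close> 50) where
  sub_refl: "U \<sqsubseteq> U"
| sub_trans: "U1 \<sqsubseteq> U2 \<Longrightarrow> U2 \<sqsubseteq> U3 \<Longrightarrow> U1 \<sqsubseteq> U3"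
| sub_inter_left: "U1 \<sqinter> U2 \<sqsubseteq> U1"
| sub_inter_mono: "U1 \<sqsubseteq> V1 \<Longrightarrow> U2 \<sqsubseteq> V2 \<Longrightarrow> U1 \<sqinter> U2 \<sqsubseteq> V1 \<sqinter> V2"
| sub_arrow: "U2 \<sqsubseteq> U1 \<Longrightarrow> Emb T1 \<sqsubseteq> Emb T2 \<Longrightarrow> Emb (U1 \<^bold>\<rightarrow> T1) \<sqsubseteq> Emb (U2 \<^bold>\<rightarrow> T2)"

inductive sub_env :: "env \<Rightarrow> env \<Rightarrow> bool" (infix \<open>\<sqsubseteq>\<^sub>e\<close> 50) where
  sub_env_refl: "\<Gamma> \<sqsubseteq>\<^sub>e \<Gamma>"
| sub_env_trans: "\<Gamma>1 \<sqsubseteq>\<^sub>e \<Gamma>2 \<Longrightarrow> \<Gamma>2 \<sqsubseteq>\<^sub>e \<Gamma>3 \<Longrightarrow> \<Gamma>1 \<sqsubseteq>\<^sub>e \<Gamma>3"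
| sub_env_upd: "U1 \<sqsubseteq> U2 \<Longrightarrow> x \<notin> fmdom' \<Gamma> \<Longrightarrow> fmupd x U1 \<Gamma> \<sqsubseteq>\<^sub>e fmupd x U2 \<Gamma>"

inductive sub_typing :: "env \<times> ity \<Rightarrow> env \<times> ity \<Rightarrow> bool" (infix \<open>\<sqsubseteq>\<^sub>t\<close> 50) where
  sub_typing_refl: "\<Phi> \<sqsubseteq>\<^sub>t \<Phi>"
| sub_typing_trans: "\<Phi>1 \<sqsubseteq>\<^sub>t \<Phi>2 \<Longrightarrow> \<Phi>2 \<sqsubseteq>\<^sub>t \<Phi>3 \<Longrightarrow> \<Phi>1 \<sqsubseteq>\<^sub>t \<Phi>3"
| sub_typing_pair: "U1 \<sqsubseteq> U2 \<Longrightarrow> \<Gamma>2 \<sqsubseteq>\<^sub>e \<Gamma>1 \<Longrightarrow> (\<Gamma>1, U1) \<sqsubseteq>\<^sub>t (\<Gamma>2, U2)"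


section \<open>Typing\<close>

inductive typing :: "lterm \<Rightarrow> env \<Rightarrow> ity \<Rightarrow> bool" (\<open>_ \<Colon> \<langle>_ \<turnstile> _\<rangle>\<close> [51, 51, 51] 50) where
  ax: "Var x \<Colon> \<langle>fmupd x (Emb T) fmempty \<turnstile> Emb T\<rangle>"
| omega: "M \<Colon> \<langle>env_omega M \<turnstile> \<omega>\<rangle>"
| arrow_i: "M \<Colon> \<langle>fmupd x U \<Gamma> \<turnstile> Emb T\<rangle> \<Longrightarrow> x \<notin> fmdom' \<Gamma> \<Longrightarrow> Lam x M \<Colon> \<langle>\<Gamma> \<turnstile> Emb (U \<^bold>\<rightarrow> T)\<rangle>"
| arrow_i': "M \<Colon> \<langle>\<Gamma> \<turnstile> Emb T\<rangle> \<Longrightarrow> x \<notin> fmdom' \<Gamma> \<Longrightarrow> Lam x M \<Colon> \<langle>\<Gamma> \<turnstile> Emb (\<omega> \<^bold>\<rightarrow> T)\<rangle>"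
| arrow_e: "M1 \<Colon> \<langle>\<Gamma>1 \<turnstile> Emb (U \<^bold>\<rightarrow> T)\<rangle> \<Longrightarrow> M2 \<Colon> \<langle>\<Gamma>2 \<turnstile> U\<rangle> \<Longrightarrow> App M1 M2 \<Colon> \<langle>\<Gamma>1 \<sqinter>\<^sub>e \<Gamma>2 \<turnstile> Emb T\<rangle>"
| inter_i: "M \<Colon> \<langle>\<Gamma> \<turnstile> U1\<rangle> \<Longrightarrow> M \<Colon> \<langle>\<Gamma> \<turnstile> U2\<rangle> \<Longrightarrow> M \<Colon> \<langle>\<Gamma> \<turnstile> U1 \<sqinter> U2\<rangle>"
| sub: "M \<Colon> \<langle>\<Gamma> \<turnstile> U\<rangle> \<Longrightarrow> (\<Gamma>, U) \<sqsubseteq>\<^sub>t (\<Gamma>', U') \<Longrightarrow> M \<Colon> \<langle>\<Gamma>' \<turnstile> U'\<rangle>"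

end

theory Submission
  imports Defs
begin

text \<open>A typing of \<open>M\<close> amounts to membership in the interpretation of \<open>M\<close> in the filter model: a
  variable denotes a set of types, \<open>\<lambda>x. M\<close> denotes the arrows \<open>U \<rightarrow> T\<close> with \<open>T\<close> in the denotation of
  \<open>M\<close> when \<open>x\<close> denotes the filter of \<open>U\<close>, and application is defined accordingly. This
  interpretation depends only on the free variables, satisfies a substitution lemma, and therefore
  can only grow under \<open>\<beta>\<close>-reduction. As the domain of the environment in a typing of \<open>M\<close> is always
  \<open>FV M\<close>, going back from the model to the type system restricts the environment to \<open>FV N\<close>.\<close>

section \<open>Inversion of subtyping\<close>

text \<open>Every rule of \<open>ty_eq\<close> keeps the head constructor and relates the arguments
  by the congruences, so this destructor respects the quotient. It is what makes
  \<open>Arrow\<close> injective.\<close>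

lift_definition dest_ty :: "ty \<Rightarrow> atom + ity \<times> ty"
  is "\<lambda>T. case T of RAtom a \<Rightarrow> Inl a | RArrow U T' \<Rightarrow> Inr (abs_ity U, abs_ty T')"
proof -
  fix T1 T2
  assume "ty_eq T1 T2"
  then show "(case T1 of RAtom a \<Rightarrow> Inl a | RArrow U T' \<Rightarrow> Inr (abs_ity U, abs_ty T'))
      = (case T2 of RAtom a \<Rightarrow> Inl a | RArrow U T' \<Rightarrow> Inr (abs_ity U, abs_ty T'))"
    \<comment> \<open>The trivial predicate for \<open>ity_eq\<close> suffices: in the arrow case
      the premise \<open>ity_eq U1 U2\<close> itself equates the two domain classes.\<close>
    by (induction rule: ty_eq_ity_eq.inducts(1)[where ?P2.0 = "\<lambda>_ _. True"])
      (auto simp: ty.abs_eq_iff ity.abs_eq_iff)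
qed

lemma dest_ty_Arrow: "dest_ty (U \<^bold>\<rightarrow> T) = Inr (U, T)"
proof (induction U; induction T)
  fix U :: rity and T :: rty
  show "dest_ty (abs_ity U \<^bold>\<rightarrow> abs_ty T) = Inr (abs_ity U, abs_ty T)"
    by (simp add: Arrow.abs_eq dest_ty.abs_eq)
qed

lemma Arrow_inject [simp]: "U \<^bold>\<rightarrow> T = U' \<^bold>\<rightarrow> T' \<longleftrightarrow> U = U' \<and> T = T'"
  by (metis dest_ty_Arrow Pair_inject sum.inject(2))

text \<open>Union of sets is commutative, associative and idempotent with unit \<open>{}\<close>, so
  the set of top-level components, with values in the quotient \<open>ty\<close>, is invariant under
  \<open>ity_eq\<close>.\<close>

primrec rcomps :: "rity \<Rightarrow> ty set" where
  "rcomps ROmega = {}"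
| "rcomps (RInter U V) = rcomps U \<union> rcomps V"
| "rcomps (REmb T) = {abs_ty T}"

lift_definition comps :: "ity \<Rightarrow> ty set" is rcomps
proof -
  fix U V
  assume "ity_eq U V"
  then show "rcomps U = rcomps V"
    by (induction rule: ty_eq_ity_eq.inducts(2)[where ?P1.0 = "\<lambda>_ _. True"])
      (auto simp: ty.abs_eq_iff)
qed

lemma comps_simps [simp]:
  "comps \<omega> = {}"
  "comps (U \<sqinter> V) = comps U \<union> comps V"
  by (transfer, simp)+

lemma comps_Emb [simp]: "comps (Emb T) = {T}"
proof (induction T)
  fix T :: rty
  show "comps (Emb (abs_ty T)) = {abs_ty T}"
    by (simp add: Emb.abs_eq comps.abs_eq)
qed

lemma ity_induct [case_names Omega Inter Emb]:
  assumes "P \<omega>" "\<And>U V. P U \<Longrightarrow> P V \<Longrightarrow> P (U \<sqinter> V)" "\<And>T. P (Emb T)"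
  shows "P U"
proof (induction U)
  fix U :: rity
  show "P (abs_ity U)"
  proof (induction U rule: rity.induct[where ?P1.0 = "\<lambda>_. True"])
    case (RInter U V)
    then show ?case using assms(2) by (metis Inter.abs_eq)
  qed (use assms in \<open>auto simp flip: Omega.abs_eq Emb.abs_eq\<close>)
qed

section \<open>Subtyping analysed through components\<close>

lemma sub_inter_right: "U \<sqinter> V \<sqsubseteq> V"
  by (metis Inter_laws(1) sub_inter_left)

lemma sub_omega: "U \<sqsubseteq> \<omega>"
  by (metis Inter_laws(4) sub_inter_left)

lemma sub_comps: "T \<in> comps U \<Longrightarrow> U \<sqsubseteq> Emb T"
  by (induction U rule: ity_induct)
    (auto intro: sub_refl sub_trans[OF sub_inter_left] sub_trans[OF sub_inter_right])

text \<open>What subtyping between two types of sort \<open>ty\<close> amounts to once transitivity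
  is eliminated: identity or one use of the arrow rule.\<close>

definition sub_ty :: "ty \<Rightarrow> ty \<Rightarrow> bool" where
  "sub_ty S T \<longleftrightarrow> S = T \<or> (\<exists>U1 T1 U2 T2. S = U1 \<^bold>\<rightarrow> T1 \<and> T = U2 \<^bold>\<rightarrow> T2 \<and> U2 \<sqsubseteq> U1 \<and> Emb T1 \<sqsubseteq> Emb T2)"

lemma sub_ty_trans: "sub_ty R S \<Longrightarrow> sub_ty S T \<Longrightarrow> sub_ty R T"
  unfolding sub_ty_def using sub_trans by (metis Arrow_inject)

lemma sub_ty_imp_sub: "sub_ty S T \<Longrightarrow> Emb S \<sqsubseteq> Emb T"
  unfolding sub_ty_def by (auto intro: sub_refl sub_arrow)

text \<open>Phrased with components because a transitivity step may pass through an intersection,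
  where a statement about \<open>Emb\<close> types alone would yield no induction
  hypothesis.\<close>

lemma sub_ity_comps: "U \<sqsubseteq> V \<Longrightarrow> T \<in> comps V \<Longrightarrow> \<exists>S \<in> comps U. sub_ty S T"
proof (induction arbitrary: T rule: sub_ity.induct)
  case (sub_refl U)
  then show ?case by (auto simp: sub_ty_def)
next
  case (sub_trans U1 U2 U3)
  then obtain S where S: "S \<in> comps U2" "sub_ty S T" by blast
  with sub_trans.IH(1) obtain R where "R \<in> comps U1" "sub_ty R S" by blast
  with S(2) show ?case by (blast intro: sub_ty_trans)
next
  case (sub_inter_left U1 U2)
  then show ?case by (auto simp: sub_ty_def)
next
  case (sub_inter_mono U1 V1 U2 V2)
  then show ?case unfolding comps_simps by blast
next
  case (sub_arrow U2 U1 T1 T2)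
  then show ?case by (auto simp: sub_ty_def)
qed

text \<open>The principal filter of \<open>U\<close>, recorded through its members of sort
  \<open>ty\<close> only; thus \<omega> gives the empty set and intersection becomes plain
  union.\<close>

definition filt :: "ity \<Rightarrow> ty set" where
  "filt U = {T. U \<sqsubseteq> Emb T}"

lemma filt_omega [simp]: "filt \<omega> = {}"
  using sub_ity_comps by (fastforce simp: filt_def)

text \<open>By inversion, types of sort \<open>ty\<close> are prime: one above an intersection is
  already above a single component.\<close>

lemma filt_Inter [simp]: "filt (U \<sqinter> V) = filt U \<union> filt V"
proof
  show "filt (U \<sqinter> V) \<subseteq> filt U \<union> filt V"
  proof
    fix T assume "T \<in> filt (U \<sqinter> V)"
    then obtain S where "S \<in> comps U \<union> comps V" "sub_ty S T"
      using sub_ity_comps[of "U \<sqinter> V" "Emb T" T] by (auto simp: filt_def)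
    then show "T \<in> filt U \<union> filt V"
      unfolding filt_def using sub_comps sub_ty_imp_sub sub_trans by blast
  qed
  show "filt U \<union> filt V \<subseteq> filt (U \<sqinter> V)"
    by (auto simp: filt_def intro: sub_trans[OF sub_inter_left] sub_trans[OF sub_inter_right])
qed

lemma filt_Emb_self [simp]: "T \<in> filt (Emb T)"
  by (simp add: filt_def sub_refl)

lemma filt_antimono: "U \<sqsubseteq> V \<Longrightarrow> filt V \<subseteq> filt U"
  unfolding filt_def using sub_trans by blast

lemma filt_Emb_Arrow:
  assumes "S \<in> filt (Emb (U \<^bold>\<rightarrow> T))"
  obtains U' T' where "S = U' \<^bold>\<rightarrow> T'" "U' \<sqsubseteq> U" "Emb T \<sqsubseteq> Emb T'"
proof -
  have "sub_ty (U \<^bold>\<rightarrow> T) S"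
    using assms sub_ity_comps[of "Emb (U \<^bold>\<rightarrow> T)" "Emb S" S] by (simp add: filt_def)
  then show ?thesis
    using that sub_refl unfolding sub_ty_def by auto
qed


section \<open>Subtyping of environments\<close>

lemma fmlookup_env_omega [simp]:
  "fmlookup (env_omega M) x = (if x \<in> FV M then Some \<omega> else None)"
  by (rule env_omega.rep_eq[THEN fun_cong])

lemma fmlookup_env_inter [simp]:
  "fmlookup (\<Gamma>1 \<sqinter>\<^sub>e \<Gamma>2) x = (case (fmlookup \<Gamma>1 x, fmlookup \<Gamma>2 x) of
     (Some U, Some V) \<Rightarrow> Some (U \<sqinter> V)
   | (Some U, None) \<Rightarrow> Some U
   | (None, V) \<Rightarrow> V)"
  by (rule env_inter.rep_eq[THEN fun_cong])

lemma sub_env_imp_rel: "\<Gamma> \<sqsubseteq>\<^sub>e \<Gamma>' \<Longrightarrow> fmrel (\<sqsubseteq>) \<Gamma> \<Gamma>'"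
proof (induction rule: sub_env.induct)
  case (sub_env_refl \<Gamma>)
  then show ?case by (intro fmap.rel_refl) (rule sub_refl)
next
  case (sub_env_trans \<Gamma>1 \<Gamma>2 \<Gamma>3)
  then have "fmrel ((\<sqsubseteq>) OO (\<sqsubseteq>)) \<Gamma>1 \<Gamma>3" by (auto simp: fmap.rel_compp)
  then show ?case by (rule fmap.rel_mono_strong) (auto intro: sub_trans)
next
  case (sub_env_upd U1 U2 x \<Gamma>)
  then show ?case by (intro fmrel_upd fmap.rel_refl) (auto intro: sub_refl)
qed

text \<open>Declarations of distinct variables commute, so a change made elsewhere can be carried
  out beside a fixed declaration of \<open>x\<close>.\<close>

lemma sub_env_fmupd: "\<Gamma> \<sqsubseteq>\<^sub>e \<Gamma>' \<Longrightarrow> x \<notin> fmdom' \<Gamma> \<Longrightarrow> fmupd x U \<Gamma> \<sqsubseteq>\<^sub>e fmupd x U \<Gamma>'"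
proof (induction rule: sub_env.induct)
  case (sub_env_trans \<Gamma>1 \<Gamma>2 \<Gamma>3)
  then have "x \<notin> fmdom' \<Gamma>2" using fmrel_fmdom'_eq[OF sub_env_imp_rel] by blast
  then show ?case using sub_env_trans by (meson sub_env.sub_env_trans)
next
  case (sub_env_upd U1 U2 y \<Gamma>)
  then have "fmupd y V (fmupd x U \<Gamma>) = fmupd x U (fmupd y V \<Gamma>)" for V
    by (intro fmupd_reorder_neq) auto
  then show ?case
    using sub_env.sub_env_upd[of U1 U2 y "fmupd x U \<Gamma>"] sub_env_upd by simp
qed (rule sub_env_refl)

text \<open>Declarations are weakened one at a time: first those of \<Gamma> beside
  \<open>x : U\<close>, then \<open>U\<close> itself. Hence environment subtyping is pointwise on
  equal domains.\<close>

lemma rel_imp_sub_env: "fmrel (\<sqsubseteq>) \<Gamma> \<Gamma>' \<Longrightarrow> \<Gamma> \<sqsubseteq>\<^sub>e \<Gamma>'"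
proof (induction \<Gamma> arbitrary: \<Gamma>')
  case fmempty
  then have "\<Gamma>' = fmempty" using fmrelD by (intro fmap_ext) force
  then show ?case by (simp add: sub_env_refl)
next
  case (fmupd x U \<Gamma>)
  have x: "x \<notin> fmdom' \<Gamma>" using fmupd.hyps by (simp add: fmdom'_notI)
  obtain V where V: "fmlookup \<Gamma>' x = Some V" "U \<sqsubseteq> V"
    using fmrelD[OF fmupd.prems, of x] by (auto elim: option.rel_cases)
  define \<Delta> where "\<Delta> = fmdrop x \<Gamma>'"
  have \<Gamma>': "\<Gamma>' = fmupd x V \<Delta>"
    unfolding \<Delta>_def using V by (intro fmap_ext) auto
  have "fmrel (\<sqsubseteq>) \<Gamma> \<Delta>"
  proof
    fix y show "rel_option (\<sqsubseteq>) (fmlookup \<Gamma> y) (fmlookup \<Delta> y)"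
      using fmrelD[OF fmupd.prems, of y] fmupd.hyps by (cases "y = x") (auto simp: \<Delta>_def)
  qed
  then have "\<Gamma> \<sqsubseteq>\<^sub>e \<Delta>" by (rule fmupd.IH)
  then have "fmupd x U \<Gamma> \<sqsubseteq>\<^sub>e fmupd x U \<Delta>" using x by (rule sub_env_fmupd)
  also have "fmupd x U \<Delta> \<sqsubseteq>\<^sub>e \<Gamma>'"
    unfolding \<Gamma>' using V(2) by (rule sub_env_upd) (simp add: \<Delta>_def)
  finally (sub_env_trans) show ?case .
qed

lemma sub_env_iff: "\<Gamma> \<sqsubseteq>\<^sub>e \<Gamma>' \<longleftrightarrow> fmrel (\<sqsubseteq>) \<Gamma> \<Gamma>'"
  using rel_imp_sub_env sub_env_imp_rel by blast

lemma sub_typing_imp: "\<Phi> \<sqsubseteq>\<^sub>t \<Psi> \<Longrightarrow> fst \<Psi> \<sqsubseteq>\<^sub>e fst \<Phi> \<and> snd \<Phi> \<sqsubseteq> snd \<Psi>"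
  by (induction rule: sub_typing.induct)
    (auto intro: sub_env_refl sub_refl sub_env_trans sub_trans)

lemma typing_sub: "M \<Colon> \<langle>\<Gamma> \<turnstile> U\<rangle> \<Longrightarrow> \<Gamma>' \<sqsubseteq>\<^sub>e \<Gamma> \<Longrightarrow> U \<sqsubseteq> U' \<Longrightarrow> M \<Colon> \<langle>\<Gamma>' \<turnstile> U'\<rangle>"
  by (rule sub) (auto intro: sub_typing_pair)


section \<open>The filter model\<close>

text \<open>\<open>U\<close> ranges over all of \<open>ity\<close>. For \<open>U\<close> = \<omega>
  the inclusion in the application clause is vacuous, mirroring the rule \<open>omega\<close>, which
  types every argument.\<close>

primrec rinterp :: "rterm \<Rightarrow> (var \<Rightarrow> ty set) \<Rightarrow> ty set" where
  "rinterp (RVar x) \<rho> = \<rho> x"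
| "rinterp (RLam x M) \<rho> = {U \<^bold>\<rightarrow> T |U T. T \<in> rinterp M (\<rho>(x := filt U))}"
| "rinterp (RApp M N) \<rho> = {T. \<exists>U. U \<^bold>\<rightarrow> T \<in> rinterp M \<rho> \<and> filt U \<subseteq> rinterp N \<rho>}"

lemma rinterp_cong: "(\<And>x. x \<in> rFV M \<Longrightarrow> \<rho> x = \<rho>' x) \<Longrightarrow> rinterp M \<rho> = rinterp M \<rho>'"
proof (induction M arbitrary: \<rho> \<rho>')
  case (RLam x M)
  have "rinterp M (\<rho>(x := F)) = rinterp M (\<rho>'(x := F))" for F
    by (rule RLam.IH) (use RLam.prems in auto)
  then show ?case by simp
next
  case (RApp M N)
  have "rinterp M \<rho> = rinterp M \<rho>'" "rinterp N \<rho> = rinterp N \<rho>'"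
    by (rule RApp.IH, use RApp.prems in simp)+
  then show ?case by simp
qed simp

text \<open>The substitution lemma, for simultaneous substitutions because each traversed binder
  adds a renaming to \<sigma>.\<close>

lemma rinterp_rsubst: "rinterp (rsubst M \<sigma>) \<rho> = rinterp M (\<lambda>y. rinterp (\<sigma> y) \<rho>)"
proof (induction M arbitrary: \<sigma> \<rho>)
  case (RLam x M)
  define z where "z = fresh (\<Union>y \<in> rFV M - {x}. rFV (\<sigma> y))"
  have z: "z \<notin> (\<Union>y \<in> rFV M - {x}. rFV (\<sigma> y))"
    unfolding z_def by (rule fresh_notin) auto
  \<comment> \<open>The new name \<open>z\<close> is fresh for the images of the other free
    variables, so the update at \<open>z\<close> affects only the value for
    \<open>x\<close>.\<close>
  have "rinterp M (\<lambda>y. rinterp ((\<sigma>(x := RVar z)) y) (\<rho>(z := F)))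
      = rinterp M ((\<lambda>y. rinterp (\<sigma> y) \<rho>)(x := F))" for F
  proof (rule rinterp_cong)
    fix y assume y: "y \<in> rFV M"
    show "rinterp ((\<sigma>(x := RVar z)) y) (\<rho>(z := F)) = ((\<lambda>y. rinterp (\<sigma> y) \<rho>)(x := F)) y"
    proof (cases "y = x")
      case False
      then have "z \<notin> rFV (\<sigma> y)" using y z by blast
      then have "rinterp (\<sigma> y) (\<rho>(z := F)) = rinterp (\<sigma> y) \<rho>"
        by (intro rinterp_cong) auto
      then show ?thesis using False by simp
    qed simp
  qed
  then show ?case by (simp add: Let_def RLam.IH flip: z_def del: fun_upd_apply)
qed simp_all

lift_definition interp :: "lterm \<Rightarrow> (var \<Rightarrow> ty set) \<Rightarrow> ty set" is rinterp
proof -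
  fix M N
  assume "alpha M N"
  then show "rinterp M = rinterp N"
  proof (induction rule: alpha.induct)
    case (alpha_rename y x M)
    \<comment> \<open>Either \<open>y = x\<close> or \<open>y\<close> is not free in
      \<open>M\<close>; both ways, \<open>x\<close> is the only free variable of \<open>M\<close>
      whose value changes.\<close>
    have "rinterp M (\<lambda>w. rinterp ((RVar(x := RVar y)) w) (\<rho>(y := F)))
        = rinterp M (\<rho>(x := F))" for \<rho> F
      by (rule rinterp_cong) (use alpha_rename in auto)
    then show ?case by (auto simp: fun_eq_iff rinterp_rsubst)
  qed (auto simp: fun_eq_iff)
qed

lemma interp_simps [simp]:
  "interp (Var x) \<rho> = \<rho> x"
  "interp (Lam x M) \<rho> = {U \<^bold>\<rightarrow> T |U T. T \<in> interp M (\<rho>(x := filt U))}"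
  "interp (App M N) \<rho> = {T. \<exists>U. U \<^bold>\<rightarrow> T \<in> interp M \<rho> \<and> filt U \<subseteq> interp N \<rho>}"
  by (transfer, simp)+

lemma interp_cong: "(\<And>x. x \<in> FV M \<Longrightarrow> \<rho> x = \<rho>' x) \<Longrightarrow> interp M \<rho> = interp M \<rho>'"
  by transfer (rule rinterp_cong)

lemma interp_subst: "interp (M[x ::= N]) \<rho> = interp M (\<rho>(x := interp N \<rho>))"
proof transfer
  fix M N x \<rho>
  show "rinterp (rsubst M (RVar(x := N))) \<rho> = rinterp M (\<rho>(x := rinterp N \<rho>))"
    unfolding rinterp_rsubst by (rule rinterp_cong) simp
qed

lemma lterm_induct [case_names Var Lam App]:
  assumes "\<And>x. P (Var x)" "\<And>x M. P M \<Longrightarrow> P (Lam x M)" "\<And>M N. P M \<Longrightarrow> P N \<Longrightarrow> P (App M N)"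
  shows "P M"
proof (induction M)
  fix M :: rterm
  show "P (abs_lterm M)"
    by (induction M) (use assms in \<open>auto simp flip: Var.abs_eq Lam.abs_eq App.abs_eq\<close>)
qed

text \<open>The valuation occurs only positively: the filters \<open>filt U\<close> tested in the
  clauses do not depend on it.\<close>

lemma interp_mono: "(\<And>x. \<rho> x \<subseteq> \<rho>' x) \<Longrightarrow> interp M \<rho> \<subseteq> interp M \<rho>'"
proof (induction M arbitrary: \<rho> \<rho>' rule: lterm_induct)
  case (Lam x M)
  have "interp M (\<rho>(x := F)) \<subseteq> interp M (\<rho>'(x := F))" for F
    by (rule Lam.IH) (use Lam.prems in auto)
  then show ?case by auto
next
  case (App M N)
  have "interp M \<rho> \<subseteq> interp M \<rho>'" "interp N \<rho> \<subseteq> interp N \<rho>'"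
    using App.prems by (rule App.IH)+
  then show ?case by (auto 0 4)
qed auto

lemma interp_fun_upd_mono: "F \<subseteq> G \<Longrightarrow> interp M (\<rho>(x := F)) \<subseteq> interp M (\<rho>(x := G))"
  by (rule interp_mono) simp

section \<open>Denotations under subtyping and reduction\<close>

definition up_closed :: "ty set \<Rightarrow> bool" where
  "up_closed F \<longleftrightarrow> (\<forall>S \<in> F. filt (Emb S) \<subseteq> F)"

lemma up_closed_filt: "up_closed (filt U)"
  unfolding up_closed_def filt_def using sub_trans by blast

text \<open>For an abstraction, passing to a smaller domain \<open>U'\<close> enlarges the filter
  bound to \<open>x\<close>, so monotonicity keeps \<open>T\<close> and the induction hypothesis
  raises it to \<open>T'\<close>. For an application, the arrow is raised in its result.\<close>

lemma up_closed_interp: "(\<And>x. up_closed (\<rho> x)) \<Longrightarrow> up_closed (interp M \<rho>)"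
proof (induction M arbitrary: \<rho> rule: lterm_induct)
  case (Lam x M)
  have "S \<in> interp (Lam x M) \<rho>"
    if T: "T \<in> interp M (\<rho>(x := filt U))" and S: "S \<in> filt (Emb (U \<^bold>\<rightarrow> T))" for S T U
  proof -
    obtain U' T' where S: "S = U' \<^bold>\<rightarrow> T'" "U' \<sqsubseteq> U" "Emb T \<sqsubseteq> Emb T'"
      using S by (rule filt_Emb_Arrow)
    have "up_closed (interp M (\<rho>(x := filt U')))"
      by (rule Lam.IH) (simp add: Lam.prems up_closed_filt)
    moreover have "T \<in> interp M (\<rho>(x := filt U'))"
      using T interp_fun_upd_mono[OF filt_antimono[OF S(2)]] by blast
    ultimately show ?thesis using S by (auto simp: up_closed_def filt_def)
  qed
  then show ?case by (auto simp: up_closed_def)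
next
  case (App M N)
  have "T' \<in> interp (App M N) \<rho>"
    if "U \<^bold>\<rightarrow> T \<in> interp M \<rho>" "filt U \<subseteq> interp N \<rho>" "Emb T \<sqsubseteq> Emb T'" for T T' U
  proof -
    have "U \<^bold>\<rightarrow> T' \<in> filt (Emb (U \<^bold>\<rightarrow> T))"
      unfolding filt_def using that(3) by (simp add: sub_arrow sub_refl)
    then have "U \<^bold>\<rightarrow> T' \<in> interp M \<rho>"
      using that(1) App.IH(1)[of \<rho>] App.prems by (auto simp: up_closed_def)
    then show ?thesis using that(2) by auto
  qed
  then show ?case by (auto simp: up_closed_def filt_def)
qed simp

lemma filt_subset_interp:
  assumes "T \<in> F" "up_closed F"
  shows "filt (Emb T) \<subseteq> F"
  using assms by (auto simp: up_closed_def)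

text \<open>For a redex, the argument filter \<open>filt U\<close> lies inside the denotation of
  \<open>N\<close>, which the substitution lemma assigns to \<open>x\<close> in the contractum;
  monotonicity concludes.\<close>

lemma interp_beta: "M \<rhd>\<^sub>\<beta> N \<Longrightarrow> interp M \<rho> \<subseteq> interp N \<rho>"
proof (induction arbitrary: \<rho> rule: beta.induct)
  case (beta_redex x M N)
  have "T \<in> interp (M[x ::= N]) \<rho>"
    if "T \<in> interp M (\<rho>(x := filt U))" "filt U \<subseteq> interp N \<rho>" for T U
    unfolding interp_subst using that interp_fun_upd_mono by blast
  then show ?case by auto
next
  case (beta_lam M M' x)
  then show ?case by fastforce
next
  case (beta_appL M M' N)
  then show ?case by fastforce
next
  case (beta_appR N N' M)
  then show ?case unfolding interp_simps by blast
qed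


section \<open>Soundness and completeness of the typing rules for the filter model\<close>

text \<open>An undeclared variable gets the empty set, which is also the filter of \<omega>; domains
  therefore have to be tracked separately.\<close>

definition env_filt :: "env \<Rightarrow> var \<Rightarrow> ty set" where
  "env_filt \<Gamma> x = (case fmlookup \<Gamma> x of None \<Rightarrow> {} | Some U \<Rightarrow> filt U)"

lemma env_filt_fmupd [simp]: "env_filt (fmupd x U \<Gamma>) = (env_filt \<Gamma>)(x := filt U)"
  by (auto simp: env_filt_def fun_eq_iff)

lemma env_filt_inter [simp]: "env_filt (\<Gamma>1 \<sqinter>\<^sub>e \<Gamma>2) x = env_filt \<Gamma>1 x \<union> env_filt \<Gamma>2 x"
  by (auto simp: env_filt_def split: option.splits)

lemma env_filt_antimono:
  assumes "\<Gamma> \<sqsubseteq>\<^sub>e \<Gamma>'"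
  shows "env_filt \<Gamma>' x \<subseteq> env_filt \<Gamma> x"
  using fmrelD[of "(\<sqsubseteq>)" \<Gamma> \<Gamma>' x] assms
  by (auto simp: sub_env_iff env_filt_def split: option.splits dest!: filt_antimono)

lemma up_closed_interp_env: "up_closed (interp M (env_filt \<Gamma>))"
  by (rule up_closed_interp)
    (auto simp: env_filt_def up_closed_filt up_closed_def[of "{}"] split: option.splits)

lemma typing_dom: "M \<Colon> \<langle>\<Gamma> \<turnstile> U\<rangle> \<Longrightarrow> fmdom' \<Gamma> = FV M"
proof (induction rule: typing.induct)
  case (omega M)
  then show ?case by (auto simp: fmlookup_dom'_iff split: if_splits)
next
  case (arrow_e M1 \<Gamma>1 U T M2 \<Gamma>2)
  have "x \<in> fmdom' (\<Gamma>1 \<sqinter>\<^sub>e \<Gamma>2) \<longleftrightarrow> x \<in> fmdom' \<Gamma>1 \<union> fmdom' \<Gamma>2" for x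
    by (auto simp: fmlookup_dom'_iff split: option.splits)
  with arrow_e.IH show ?case by auto
next
  case (sub M \<Gamma> U \<Gamma>' U')
  then show ?case
    using sub_typing_imp[OF sub.hyps(2)] by (auto simp: sub_env_iff dest: fmrel_fmdom'_eq)
qed auto

text \<open>When the derived type is a single arrow or atom, its membership is enough: upward
  closure supplies the rest of its filter.\<close>

lemma typing_sound: "M \<Colon> \<langle>\<Gamma> \<turnstile> U\<rangle> \<Longrightarrow> filt U \<subseteq> interp M (env_filt \<Gamma>)"
proof (induction rule: typing.induct)
  case (arrow_i M x U \<Gamma> T)
  then have "T \<in> interp M ((env_filt \<Gamma>)(x := filt U))"
    using filt_Emb_self unfolding env_filt_fmupd by blast
  then show ?case by (intro filt_subset_interp up_closed_interp_env) simp
next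
  case (arrow_i' M \<Gamma> T x)
  \<comment> \<open>Binding \<open>x\<close> to the filter of \<omega> changes nothing, since
    \<open>x\<close> is undeclared.\<close>
  then have "(env_filt \<Gamma>)(x := {}) = env_filt \<Gamma>"
    by (auto simp: env_filt_def fun_eq_iff fmdom'_notD)
  moreover have "T \<in> interp M (env_filt \<Gamma>)"
    using arrow_i'.IH filt_Emb_self by blast
  ultimately show ?case by (intro filt_subset_interp up_closed_interp_env) simp
next
  case (arrow_e M1 \<Gamma>1 U T M2 \<Gamma>2)
  have "interp M (env_filt \<Gamma>1) \<subseteq> interp M (env_filt (\<Gamma>1 \<sqinter>\<^sub>e \<Gamma>2))"
    "interp M (env_filt \<Gamma>2) \<subseteq> interp M (env_filt (\<Gamma>1 \<sqinter>\<^sub>e \<Gamma>2))" for M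
    by (auto intro!: interp_mono)
  with arrow_e have "T \<in> interp (App M1 M2) (env_filt (\<Gamma>1 \<sqinter>\<^sub>e \<Gamma>2))"
    unfolding interp_simps using filt_Emb_self by blast
  then show ?case by (intro filt_subset_interp up_closed_interp_env)
next
  case (sub M \<Gamma> U \<Gamma>' U')
  then have "\<Gamma>' \<sqsubseteq>\<^sub>e \<Gamma>" "U \<sqsubseteq> U'" using sub_typing_imp by fastforce+
  have "filt U' \<subseteq> filt U" using \<open>U \<sqsubseteq> U'\<close> by (rule filt_antimono)
  also have "\<dots> \<subseteq> interp M (env_filt \<Gamma>)" by (rule sub.IH)
  also have "\<dots> \<subseteq> interp M (env_filt \<Gamma>')"
    using \<open>\<Gamma>' \<sqsubseteq>\<^sub>e \<Gamma>\<close> by (intro interp_mono env_filt_antimono)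
  finally show ?case .
qed auto

text \<open>Every \<open>U\<close> is built from \<omega> and types of sort \<open>ty\<close> by
  intersection, so \<open>inter_i\<close> assembles the separate typings.\<close>

lemma typing_filtI:
  assumes "\<And>T. T \<in> filt U \<Longrightarrow> M \<Colon> \<langle>\<Gamma> \<turnstile> Emb T\<rangle>" and "fmdom' \<Gamma> = FV M"
  shows "M \<Colon> \<langle>\<Gamma> \<turnstile> U\<rangle>"
  using assms(1)
proof (induction U rule: ity_induct)
  case Omega
  \<comment> \<open>The domains agree and every declared type is below \<omega>.\<close>
  have "fmrel (\<sqsubseteq>) \<Gamma> (env_omega M)"
  proof
    fix x
    show "rel_option (\<sqsubseteq>) (fmlookup \<Gamma> x) (fmlookup (env_omega M) x)"
      unfolding fmlookup_env_omega assms(2)[symmetric] fmlookup_dom'_iff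
      by (cases "fmlookup \<Gamma> x") (simp_all add: sub_omega)
  qed
  then show ?case by (intro typing_sub[OF omega]) (simp_all add: sub_env_iff sub_refl)
next
  case (Inter U V)
  then show ?case by (intro inter_i) simp_all
qed simp

section \<open>Restriction of environments and completeness\<close>

lemma fmlookup_env_restrict [simp]:
  "fmlookup (\<Gamma> \<restriction> M) x = (if x \<in> FV M then fmlookup \<Gamma> x else None)"
  by (simp add: env_restrict_def)

lemma fmdom'_env_restrict [simp]: "fmdom' (\<Gamma> \<restriction> M) = fmdom' \<Gamma> \<inter> FV M"
  by (auto simp: fmlookup_dom'_iff split: if_splits)

text \<open>Shared variables carry the same type on both sides, so idempotence restores it; this
  splits an environment for \<open>arrow_e\<close>.\<close>

lemma env_restrict_Un:
  assumes "fmdom' \<Gamma> \<subseteq> FV M \<union> FV N"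
  shows "(\<Gamma> \<restriction> M) \<sqinter>\<^sub>e (\<Gamma> \<restriction> N) = \<Gamma>"
proof (rule fmap_ext)
  fix x
  show "fmlookup ((\<Gamma> \<restriction> M) \<sqinter>\<^sub>e (\<Gamma> \<restriction> N)) x = fmlookup \<Gamma> x"
    using assms by (cases "fmlookup \<Gamma> x") (auto simp: Inter_laws(3) dest: fmdom'I)
qed

lemma interp_env_restrict: "interp M (env_filt (\<Gamma> \<restriction> M)) = interp M (env_filt \<Gamma>)"
  by (rule interp_cong) (simp add: env_filt_def)

lemma typing_complete_ty:
  "T \<in> interp M (env_filt \<Gamma>) \<Longrightarrow> fmdom' \<Gamma> = FV M \<Longrightarrow> M \<Colon> \<langle>\<Gamma> \<turnstile> Emb T\<rangle>"
proof (induction M arbitrary: \<Gamma> T rule: lterm_induct)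
  case (Var x)
  then obtain U where U: "fmlookup \<Gamma> x = Some U" "U \<sqsubseteq> Emb T"
    by (auto simp: env_filt_def filt_def split: option.splits)
  then have \<Gamma>: "\<Gamma> = fmupd x U fmempty"
    using Var(2) by (intro fmap_ext) (auto simp: fmdom'_notD)
  show ?case
    by (rule typing_sub[OF ax]) (use U(2) in \<open>auto simp: \<Gamma> intro: sub_env_upd sub_refl\<close>)
next
  case (Lam x M)
  then obtain U T' where T: "T = U \<^bold>\<rightarrow> T'" "T' \<in> interp M ((env_filt \<Gamma>)(x := filt U))" by auto
  have x: "x \<notin> fmdom' \<Gamma>" using Lam.prems(2) by simp
  show ?case
  \<comment> \<open>The domain of a typing equals the free variables, so this decides between
    \<open>arrow_i\<close> and \<open>arrow_i'\<close>.\<close>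
  proof (cases "x \<in> FV M")
    case True
    have "M \<Colon> \<langle>fmupd x U \<Gamma> \<turnstile> Emb T'\<rangle>"
    proof (rule Lam.IH)
      show "T' \<in> interp M (env_filt (fmupd x U \<Gamma>))" using T(2) by (simp only: env_filt_fmupd)
      show "fmdom' (fmupd x U \<Gamma>) = FV M" using True Lam.prems(2) by auto
    qed
    then show ?thesis unfolding T(1) using x by (rule arrow_i)
  next
    case False
    have "interp M ((env_filt \<Gamma>)(x := filt U)) = interp M (env_filt \<Gamma>)"
      by (rule interp_cong) (use False in auto)
    then have "M \<Colon> \<langle>\<Gamma> \<turnstile> Emb T'\<rangle>"
      using T(2) False Lam.prems(2) by (intro Lam.IH) (simp_all del: fun_upd_apply)
    then have "Lam x M \<Colon> \<langle>\<Gamma> \<turnstile> Emb (\<omega> \<^bold>\<rightarrow> T')\<rangle>" using x by (rule arrow_i')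
    then show ?thesis
      \<comment> \<open>Contravariance, with \<open>U\<close> below \<omega>, turns the domain
        \<omega> into \<open>U\<close>.\<close>
      unfolding T(1) by (rule typing_sub) (auto intro: sub_env_refl sub_arrow sub_omega sub_refl)
  qed
next
  case (App M N)
  then obtain U where U: "U \<^bold>\<rightarrow> T \<in> interp M (env_filt \<Gamma>)" "filt U \<subseteq> interp N (env_filt \<Gamma>)" by auto
  \<comment> \<open>Both induction hypotheses ask for exactly the free variables of the subterm as
    domain.\<close>
  have dom: "fmdom' (\<Gamma> \<restriction> M) = FV M" "fmdom' (\<Gamma> \<restriction> N) = FV N"
    using App.prems(2) by auto
  have "M \<Colon> \<langle>\<Gamma> \<restriction> M \<turnstile> Emb (U \<^bold>\<rightarrow> T)\<rangle>"
    using U(1) dom(1) by (intro App.IH) (simp_all add: interp_env_restrict)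
  moreover have "N \<Colon> \<langle>\<Gamma> \<restriction> N \<turnstile> U\<rangle>"
    by (rule typing_filtI, rule App.IH) (use U(2) dom(2) in \<open>auto simp: interp_env_restrict\<close>)
  ultimately have "App M N \<Colon> \<langle>(\<Gamma> \<restriction> M) \<sqinter>\<^sub>e (\<Gamma> \<restriction> N) \<turnstile> Emb T\<rangle>" by (rule arrow_e)
  then show ?case using App.prems(2) by (simp add: env_restrict_Un)
qed

lemma typing_iff:
  "M \<Colon> \<langle>\<Gamma> \<turnstile> U\<rangle> \<longleftrightarrow> fmdom' \<Gamma> = FV M \<and> filt U \<subseteq> interp M (env_filt \<Gamma>)"
proof
  assume "M \<Colon> \<langle>\<Gamma> \<turnstile> U\<rangle>"
  then show "fmdom' \<Gamma> = FV M \<and> filt U \<subseteq> interp M (env_filt \<Gamma>)"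
    by (simp add: typing_dom typing_sound)
next
  assume "fmdom' \<Gamma> = FV M \<and> filt U \<subseteq> interp M (env_filt \<Gamma>)"
  then show "M \<Colon> \<langle>\<Gamma> \<turnstile> U\<rangle>"
    by (auto intro: typing_filtI[OF typing_complete_ty])
qed

section \<open>Free variables under reduction, and subject reduction\<close>

lemma FV_subst: "FV (M[x ::= N]) \<subseteq> FV M - {x} \<union> FV N"
  by transfer (auto simp: rFV_rsubst split: if_splits)

lemma FV_beta: "M \<rhd>\<^sub>\<beta> N \<Longrightarrow> FV N \<subseteq> FV M"
  by (induction rule: beta.induct) (use FV_subst in auto)

theorem theorem3p5:
  fixes M N :: lterm and \<Gamma> :: env and U :: ity
  assumes "M \<Colon> \<langle>\<Gamma> \<turnstile> U\<rangle>"
    and "M \<rhd>\<^sub>\<beta> N"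
  shows "N \<Colon> \<langle>\<Gamma> \<restriction> N \<turnstile> U\<rangle>"
proof -
  \<comment> \<open>Reduction creates no free variables, so \<Gamma> declares every variable of
    \<open>FV N\<close>.\<close>
  have "fmdom' (\<Gamma> \<restriction> N) = FV N"
    using assms(1) FV_beta[OF assms(2)] by (auto simp: typing_iff)
  \<comment> \<open>The denotation grows from \<open>M\<close> to \<open>N\<close> and ignores the
    declarations removed by the restriction.\<close>
  moreover have "filt U \<subseteq> interp N (env_filt (\<Gamma> \<restriction> N))"
    using assms(1) interp_beta[OF assms(2)] by (auto simp: typing_iff interp_env_restrict)
  ultimately show ?thesis by (simp add: typing_iff)
qed

end
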